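(* Let $d,M,N\ge 1$ be integers, let $\sigma:\mathbb{R}\to\mathbb{R}$ be twice differentiable, and let $\mathcal{J}^{\mathrm h}$ (the PINN loss) and $\mathcal{J}^{\mathrm h}_{\mathrm S}$ (the layer separation loss) for the hyperbolic problem be as defined in the context. Then for all network parameters $W_1\in\mathbb{R}^{M\times(d+1)}$, $W_2\in\mathbb{R}^{M\times M}$, $W_3\in\mathbb{R}^{1\times M}$, $b_1,b_2\in\mathbb{R}^{M}$, $b_3\in\mathbb{R}$ there exist auxiliary variables $a_1,a_2\in\mathbb{R}^{M\times N}$, $d_{1i},d_{2i}\in\mathbb{R}^{M\times N}$ and $q_i\in\mathbb{R}^{M\times N}$ ($i=0,\dots,d$) such that $$\mathcal{J}^{\mathrm h}_{\mathrm S}\le \mathcal{J}^{\mathrm h}.$$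
   Context: Conventions: $*$ is the entrywise (Hadamard) product; $\sigma,\sigma',\sigma''$ act entrywise on matrices; $\mathbf 1$ is the all-one column vector of length $N$; $\|\cdot\|_{\mathrm F}$ is the Frobenius norm (Euclidean norm for vectors); $|v|_\infty$ is the maximum absolute value of the entries of a vector $v$; $A(:,i)$ is the $i$-th column of $A$ and $A[n]$ the $n$-th column of an $M\times N$ matrix $A$; for a diagonal $N\times N$ matrix $\mathcal D$ with nonnegative diagonal entries, $\|A\|_{\mathcal D}=\big(\sum_{n=1}^N \mathcal D(n,n)^2\|A[n]\|_2^2\big)^{1/2}$; $I$ is the identity matrix. Data: $T>0$; $\Omega=\{x\in\mathbb{R}^d:\|x\|_2\le1\}$; $c$ is a real function, continuously differentiable on a neighbourhood of $\Omega$, with $c(x)>\delta$ on $\Omega$ for some $\delta>0$; $Q:[0,T]\times\Omega\to\mathbb{R}$; $(t_1,x_1),\dots,(t_N,x_N)\in[0,T]\times\Omega$; $y_n=Q(t_n,x_n)$; $X=[x_1\cdots x_N]\in\mathbb{R}^{d\times N}$, with $i$-th row $X(i,:)$; $Y=[y_1\cdots y_N]$; $\hat X=[\|x_1\|_2^2\cdots\|x_N\|_2^2]$, and $\hat X-1$ subtracts $1$ from each entry; $T_0=[t_1\cdots t_N]$ and $\hat T_0=[t_1^2\cdots t_N^2]$ in $\mathbb{R}^{1\times N}$; $X_T\in\mathbb{R}^{(d+1)\times N}$ is $T_0$ stacked on top of $X$. $c(X)$ and $\partial_{x_i}c(X)$ are the row vectors of values $c(x_n)$ and $(\partial_{x_i}c)(x_n)$.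 The first column $W_1(:,1)$ corresponds to the time variable and $W_1(:,i+1)$ to $x_i$. PINN loss: with $\phi(t,x)=W_3\sigma(W_2\sigma(W_1[t;x]+b_1)+b_2)+b_3$, where $[t;x]\in\mathbb{R}^{d+1}$ is the column vector with entries $t,x_1,\dots,x_d$, and $\psi_{\mathrm h}(t,x)=t^2(\|x\|_2^2-1)\phi(t,x)$, $$\mathcal{J}^{\mathrm h}=\frac1N\sum_{n=1}^N\Big|\big[\partial_{tt}\psi_{\mathrm h}-\nabla_x\cdot(c\nabla_x\psi_{\mathrm h})\big](t_n,x_n)-y_n\Big|^2 .$$ Coefficient row vectors: $K^{\mathrm h}=2\big((\hat X-1)-d\,\hat T_0*c(X)-\hat T_0*\sum_{i=1}^dX(i,:)*\partial_{x_i}c(X)\big)$; $K_0^{\mathrm h}=4T_0*(\hat X-1)$; $\hat K_0^{\mathrm h}=\hat T_0*(\hat X-1)$; and for $i=1,\dots,d$: $K_i^{\mathrm h}=\hat K_0^{\mathrm h}*\partial_{x_i}c(X)+4\hat T_0*X(i,:)*c(X)$, $\hat K_i^{\mathrm h}=c(X)*\hat K_0^{\mathrm h}$. Layer separation loss: $$\mathcal{J}^{\mathrm h}_{\mathrm S}=\frac1N\Big[\Big\|K^{\mathrm h}*(W_3\sigma(a_2)+b_3\mathbf 1^\top)+K_0^{\mathrm h}*(W_3(\sigma'(a_2)*d_{20}))+\hat K_0^{\mathrm h}*(W_3(\sigma''(a_2)*d_{20}*d_{20}+\sigma'(a_2)*q_0))$$ $$-\sum_{i=1}^dK_i^{\mathrm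 h}*(W_3(\sigma'(a_2)*d_{2i}))-\sum_{i=1}^d\hat K_i^{\mathrm h}*(W_3(\sigma''(a_2)*d_{2i}*d_{2i}+\sigma'(a_2)*q_i))-Y\Big\|_{\mathrm F}^2$$ $$+\omega_{a_1}^1\|W_1X_T+b_1\mathbf 1^\top-a_1\|^2_{\mathcal D_{a_1}^1}+\sum_{k=2}^3\sum_{i=0}^d\omega_{a_1}^{ki}\|W_1X_T+b_1\mathbf 1^\top-a_1\|^2_{\mathcal D_{a_1}^{ki}}$$ $$+\omega_{a_2}^1\|W_2\sigma(a_1)+b_2\mathbf 1^\top-a_2\|^2_{\mathcal D_{a_2}^1}+\sum_{i=0}^d\omega_{a_2}^{2i}\|W_2\sigma(a_1)+b_2\mathbf 1^\top-a_2\|^2_{\mathcal D_{a_2}^{2i}}$$ $$+\sum_{k=1}^2\sum_{i=0}^d\Big(\omega_{d_{1i}}^k\|W_1(:,i+1)\mathbf 1^\top-d_{1i}\|^2_{\mathcal D_{d_{1i}}^k}+\omega_{d_{2i}}^k\|W_2(\sigma'(a_1)*d_{1i})-d_{2i}\|^2_{\mathcal D_{d_{2i}}^k}\Big)+\sum_{i=0}^d\omega_{q_i}\|W_2(\sigma''(a_1)*d_{1i}*d_{1i})-q_i\|_{\mathrm F}^2\Big],$$ with weights ($i=0,\dots,d$): $\omega_{a_1}^1=\omega_{d_{1i}}^2=\|W_3\|_{\mathrm F}^2\|W_2\|_{\mathrm F}^2$; $\omega_{a_1}^{2i}=\omega_{a_2}^{2i}=\omega_{a_1}^1\|W_1(:,i+1)\|_{\mathrm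 F}^2$; $\omega_{a_1}^{3i}=\omega_{a_1}^{2i}\|W_2\|_{\mathrm F}^2$; $\omega_{a_2}^1=\omega_{d_{2i}}^1=\|W_3\|_{\mathrm F}^2$; $\omega_{d_{1i}}^1=|\hat K_i^{\mathrm h}|_\infty^2(\omega_{a_1}^{2i}+\omega_{a_1}^{3i})$; $\omega_{d_{2i}}^2=|\hat K_i^{\mathrm h}|_\infty^2\omega_{a_1}^{2i}$; $\omega_{q_i}=|\hat K_i^{\mathrm h}|_\infty^2\omega_{a_2}^1$; and diagonal $N\times N$ matrices with diagonal entries ($i=0,\dots,d$, $n=1,\dots,N$): $\mathcal D_{a_2}^1(n,n)=\big(|K^{\mathrm h}|_\infty^2+\sum_{i=0}^d(|K_i^{\mathrm h}|_\infty^2\|d_{2i}[n]\|_{\mathrm F}^2+|\hat K_i^{\mathrm h}|_\infty^2\|q_i[n]\|_{\mathrm F}^2)\big)^{1/2}$; $\mathcal D_{a_1}^{2i}(n,n)=|\hat K_i^{\mathrm h}|_\infty\|d_{1i}[n]\|_{\mathrm F}$; $\mathcal D_{a_2}^{2i}(n,n)=|\hat K_i^{\mathrm h}|_\infty\|d_{2i}[n]\|_{\mathrm F}$; $\mathcal D_{a_1}^{3i}(n,n)=\big(\mathcal D_{a_1}^{2i}(n,n)^2+\mathcal D_{a_2}^{2i}(n,n)^2\big)^{1/2}$; $\mathcal D_{a_1}^1(n,n)=\big(\mathcal D_{a_2}^1(n,n)^2+\sum_{i=0}^d(|K_i^{\mathrm h}|_\infty^2\|d_{1i}[n]\|_{\mathrm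 F}^2+\mathcal D_{a_1}^{2i}(n,n)^2\|d_{2i}[n]\|_{\mathrm F}^2)\big)^{1/2}$; $\mathcal D_{d_{1i}}^1=\mathcal D_{d_{2i}}^2=I$; $\mathcal D_{d_{1i}}^2(n,n)=\big(|K_i^{\mathrm h}|_\infty^2+\mathcal D_{a_1}^{3i}(n,n)^2\big)^{1/2}$; $\mathcal D_{d_{2i}}^1(n,n)=\big(|K_i^{\mathrm h}|_\infty^2+\mathcal D_{a_2}^{2i}(n,n)^2\big)^{1/2}$. *)

theory Defs
  imports "HOL-Analysis.Analysis"
begin

text \<open>
  The index types \<open>'d\<close>, \<open>'m\<close>, \<open>'n\<close> stand for the index sets of size \<open>d\<close>, \<open>M\<close>, \<open>N\<close>.
  Space-time indices \<open>0, \<dots>, d\<close> live in \<open>'d option\<close>: \<open>None\<close> is the time index \<open>0\<close> and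
  \<open>Some i\<close> is the spatial index \<open>i\<close>.  A \<open>p \<times> n\<close> matrix has type \<open>real^'n^'p\<close>; row vectors
  (\<open>1 \<times> n\<close> matrices) and column vectors are both elements of \<open>real^'n\<close>, and the product of a
  row vector with a matrix is \<open>v*\<close>.

  The library operations used below have the required meaning: \<open>*\<close> on \<open>real^'n\<close> and on
  \<open>real^'n^'m\<close> is the entrywise product (and \<open>1\<close>, numerals are constant vectors), \<open>norm\<close> is the
  Euclidean norm on vectors and the Frobenius norm on matrices, and \<open>infnorm\<close> is the
  maximum absolute value of the entries.
\<close>

section \<open>Calculus\<close>

definition partial_deriv :: "'d::finite \<Rightarrow> (real^'d \<Rightarrow> real) \<Rightarrow> real^'d \<Rightarrow> real" where
  "partial_deriv i f x = deriv (\<lambda>s. f (x + s *\<^sub>R axis i 1)) 0"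

definition grad :: "(real^'d::finite \<Rightarrow> real) \<Rightarrow> real^'d \<Rightarrow> real^'d" where
  "grad f x = (\<chi> i. partial_deriv i f x)"

definition divergence :: "(real^'d::finite \<Rightarrow> real^'d) \<Rightarrow> real^'d \<Rightarrow> real" where
  "divergence F x = (\<Sum>i\<in>UNIV. partial_deriv i (\<lambda>y. F y $ i) x)"

text \<open>Meant for open \<open>U\<close>.\<close>
definition continuously_differentiable_on :: "(real^'d::finite \<Rightarrow> real) \<Rightarrow> (real^'d) set \<Rightarrow> bool" where
  "continuously_differentiable_on c U \<longleftrightarrow>
     c differentiable_on U \<and> (\<forall>i. continuous_on U (partial_deriv i c))"

definition twice_differentiable :: "(real \<Rightarrow> real) \<Rightarrow> bool" where
  "twice_differentiable f \<longleftrightarrow> (\<forall>s. f differentiable (at s)) \<and> (\<forall>s. deriv f differentiable (at s))"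


section \<open>Matrices\<close>

definition map_vec :: "('a \<Rightarrow> 'b) \<Rightarrow> 'a^'n \<Rightarrow> 'b^'n" where
  "map_vec f v = (\<chi> i. f (v $ i))"

text \<open>The \<open>m \<times> n\<close> matrix \<open>v \<one>\<^sup>T\<close>, all of whose columns are \<open>v\<close>.\<close>
definition times_ones :: "real^'m \<Rightarrow> real^'n^'m" where
  "times_ones v = (\<chi> i n. v $ i)"

definition diag_mat :: "('n \<Rightarrow> real) \<Rightarrow> real^'n^'n" where
  "diag_mat f = (\<chi> i j. if i = j then f i else 0)"

definition diag_norm :: "real^'n::finite^'n \<Rightarrow> real^'n^'m::finite \<Rightarrow> real" where
  "diag_norm D A = sqrt (\<Sum>n\<in>UNIV. (D $ n $ n)\<^sup>2 * (norm (column n A))\<^sup>2)"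

definition stack :: "'a \<Rightarrow> 'a^'d \<Rightarrow> 'a^('d option)" where
  "stack a v = (\<chi> k. case k of None \<Rightarrow> a | Some i \<Rightarrow> v $ i)"


section \<open>The PINN loss\<close>

definition network ::
  "(real \<Rightarrow> real) \<Rightarrow> real^('d::finite option)^'m::finite \<Rightarrow> real^'m^'m \<Rightarrow> real^'m \<Rightarrow>
   real^'m \<Rightarrow> real^'m \<Rightarrow> real \<Rightarrow> real \<Rightarrow> real^'d \<Rightarrow> real" where
  "network \<sigma> W1 W2 W3 b1 b2 b3 t x =
     W3 \<bullet> map_vec \<sigma> (W2 *v map_vec \<sigma> (W1 *v stack t x + b1) + b2) + b3"

definition psi_h ::
  "(real \<Rightarrow> real) \<Rightarrow> real^('d::finite option)^'m::finite \<Rightarrow> real^'m^'m \<Rightarrow> real^'m \<Rightarrow>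
   real^'m \<Rightarrow> real^'m \<Rightarrow> real \<Rightarrow> real \<Rightarrow> real^'d \<Rightarrow> real" where
  "psi_h \<sigma> W1 W2 W3 b1 b2 b3 t x =
     t\<^sup>2 * ((norm x)\<^sup>2 - 1) * network \<sigma> W1 W2 W3 b1 b2 b3 t x"

definition hyperbolic_op ::
  "(real^'d::finite \<Rightarrow> real) \<Rightarrow> (real \<Rightarrow> real^'d \<Rightarrow> real) \<Rightarrow> real \<Rightarrow> real^'d \<Rightarrow> real" where
  "hyperbolic_op c \<psi> t x =
     deriv (deriv (\<lambda>s. \<psi> s x)) t - divergence (\<lambda>y. c y *\<^sub>R grad (\<psi> t) y) x"

definition pinn_loss ::
  "(real^'d::finite \<Rightarrow> real) \<Rightarrow> (real \<times> (real^'d) \<Rightarrow> real) \<Rightarrow> ('n::finite \<Rightarrow> real) \<Rightarrow> ('n \<Rightarrow> real^'d) \<Rightarrow>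
   (real \<Rightarrow> real) \<Rightarrow> real^('d option)^'m::finite \<Rightarrow> real^'m^'m \<Rightarrow> real^'m \<Rightarrow>
   real^'m \<Rightarrow> real^'m \<Rightarrow> real \<Rightarrow> real" where
  "pinn_loss c Q t x \<sigma> W1 W2 W3 b1 b2 b3 =
     1 / real CARD('n) *
     (\<Sum>n\<in>UNIV. \<bar>hyperbolic_op c (psi_h \<sigma> W1 W2 W3 b1 b2 b3) (t n) (x n) - Q (t n, x n)\<bar>\<^sup>2)"


section \<open>Data matrices and coefficient row vectors\<close>

definition X_mat :: "('n \<Rightarrow> real^'d) \<Rightarrow> real^'n^'d" where
  "X_mat x = (\<chi> i n. x n $ i)"

definition X_hat :: "('n \<Rightarrow> real^'d::finite) \<Rightarrow> real^'n" where
  "X_hat x = (\<chi> n. (norm (x n))\<^sup>2)"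

definition T_row :: "('n \<Rightarrow> real) \<Rightarrow> real^'n" where
  "T_row t = (\<chi> n. t n)"

definition T_hat :: "('n \<Rightarrow> real) \<Rightarrow> real^'n" where
  "T_hat t = (\<chi> n. (t n)\<^sup>2)"

definition XT_mat :: "('n \<Rightarrow> real) \<Rightarrow> ('n \<Rightarrow> real^'d) \<Rightarrow> real^'n^('d option)" where
  "XT_mat t x = stack (T_row t) (X_mat x)"

definition Y_row :: "(real \<times> (real^'d) \<Rightarrow> real) \<Rightarrow> ('n \<Rightarrow> real) \<Rightarrow> ('n \<Rightarrow> real^'d) \<Rightarrow> real^'n" where
  "Y_row Q t x = (\<chi> n. Q (t n, x n))"

text \<open>Row vector of the values of \<open>f\<close> at the sample points, used for \<open>c\<close> and its partial derivatives.\<close>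
definition at_samples :: "(real^'d \<Rightarrow> real) \<Rightarrow> ('n \<Rightarrow> real^'d) \<Rightarrow> real^'n" where
  "at_samples f x = (\<chi> n. f (x n))"

definition K_h :: "(real^'d::finite \<Rightarrow> real) \<Rightarrow> ('n::finite \<Rightarrow> real) \<Rightarrow> ('n \<Rightarrow> real^'d) \<Rightarrow> real^'n" where
  "K_h c t x =
     2 *\<^sub>R ((X_hat x - 1) - real CARD('d) *\<^sub>R (T_hat t * at_samples c x)
        - T_hat t * (\<Sum>i\<in>UNIV. row i (X_mat x) * at_samples (partial_deriv i c) x))"

definition K0_hat :: "('n::finite \<Rightarrow> real) \<Rightarrow> ('n \<Rightarrow> real^'d::finite) \<Rightarrow> real^'n" where
  "K0_hat t x = T_hat t * (X_hat x - 1)"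

fun Ki_h :: "(real^'d::finite \<Rightarrow> real) \<Rightarrow> ('n::finite \<Rightarrow> real) \<Rightarrow> ('n \<Rightarrow> real^'d) \<Rightarrow> 'd option \<Rightarrow> real^'n" where
  "Ki_h c t x None = 4 *\<^sub>R (T_row t * (X_hat x - 1))"
| "Ki_h c t x (Some i) =
     K0_hat t x * at_samples (partial_deriv i c) x
     + 4 *\<^sub>R (T_hat t * row i (X_mat x) * at_samples c x)"

fun Ki_hat :: "(real^'d::finite \<Rightarrow> real) \<Rightarrow> ('n::finite \<Rightarrow> real) \<Rightarrow> ('n \<Rightarrow> real^'d) \<Rightarrow> 'd option \<Rightarrow> real^'n" where
  "Ki_hat c t x None = K0_hat t x"
| "Ki_hat c t x (Some i) = at_samples c x * K0_hat t x"


section \<open>Weights\<close>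

text \<open>
  In this section and the next one \<open>K\<close>, \<open>Ki\<close>, \<open>Kh\<close> are meant to be \<open>K_h\<close>, \<open>Ki_h\<close>, \<open>Ki_hat\<close>
  at the data, and \<open>k\<close> ranges over the space-time indices \<open>0, \<dots>, d\<close>.  The name
  \<open>omega_v_j\<close> or \<open>D_v_j\<close> stands for the quantity attached to the variable \<open>v\<close> with
  superscript \<open>j\<close> (\<open>1\<close>, \<open>2\<close>) or \<open>ji\<close>.
\<close>

definition omega_a1_1 :: "real^'m^'m::finite \<Rightarrow> real^'m \<Rightarrow> real" where
  "omega_a1_1 W2 W3 = (norm W3)\<^sup>2 * (norm W2)\<^sup>2"

definition omega_a1_2 ::
  "real^('d::finite option)^'m::finite \<Rightarrow> real^'m^'m \<Rightarrow> real^'m \<Rightarrow> 'd option \<Rightarrow> real" where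
  "omega_a1_2 W1 W2 W3 k = omega_a1_1 W2 W3 * (norm (column k W1))\<^sup>2"

definition omega_a1_3 ::
  "real^('d::finite option)^'m::finite \<Rightarrow> real^'m^'m \<Rightarrow> real^'m \<Rightarrow> 'd option \<Rightarrow> real" where
  "omega_a1_3 W1 W2 W3 k = omega_a1_2 W1 W2 W3 k * (norm W2)\<^sup>2"

definition omega_a2_1 :: "real^'m::finite \<Rightarrow> real" where
  "omega_a2_1 W3 = (norm W3)\<^sup>2"

definition omega_a2_2 ::
  "real^('d::finite option)^'m::finite \<Rightarrow> real^'m^'m \<Rightarrow> real^'m \<Rightarrow> 'd option \<Rightarrow> real" where
  "omega_a2_2 W1 W2 W3 k = omega_a1_2 W1 W2 W3 k"

definition omega_d1_1 ::
  "('d option \<Rightarrow> real^'n::finite) \<Rightarrow> real^('d::finite option)^'m::finite \<Rightarrow> real^'m^'m \<Rightarrow> real^'m \<Rightarrow>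
   'd option \<Rightarrow> real" where
  "omega_d1_1 Kh W1 W2 W3 k = (infnorm (Kh k))\<^sup>2 * (omega_a1_2 W1 W2 W3 k + omega_a1_3 W1 W2 W3 k)"

definition omega_d1_2 :: "real^'m^'m::finite \<Rightarrow> real^'m \<Rightarrow> real" where
  "omega_d1_2 W2 W3 = omega_a1_1 W2 W3"

definition omega_d2_1 :: "real^'m::finite \<Rightarrow> real" where
  "omega_d2_1 W3 = omega_a2_1 W3"

definition omega_d2_2 ::
  "('d option \<Rightarrow> real^'n::finite) \<Rightarrow> real^('d::finite option)^'m::finite \<Rightarrow> real^'m^'m \<Rightarrow> real^'m \<Rightarrow>
   'd option \<Rightarrow> real" where
  "omega_d2_2 Kh W1 W2 W3 k = (infnorm (Kh k))\<^sup>2 * omega_a1_2 W1 W2 W3 k"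

definition omega_q :: "('d option \<Rightarrow> real^'n::finite) \<Rightarrow> real^'m::finite \<Rightarrow> 'd option \<Rightarrow> real" where
  "omega_q Kh W3 k = (infnorm (Kh k))\<^sup>2 * omega_a2_1 W3"


section \<open>Diagonal weight matrices\<close>

definition D_a2_1 ::
  "real^'n::finite \<Rightarrow> ('d::finite option \<Rightarrow> real^'n) \<Rightarrow> ('d option \<Rightarrow> real^'n) \<Rightarrow>
   ('d option \<Rightarrow> real^'n^'m::finite) \<Rightarrow> ('d option \<Rightarrow> real^'n^'m) \<Rightarrow> real^'n^'n" where
  "D_a2_1 K Ki Kh d2 q = diag_mat (\<lambda>n.
     sqrt ((infnorm K)\<^sup>2 + (\<Sum>k\<in>UNIV. (infnorm (Ki k))\<^sup>2 * (norm (column n (d2 k)))\<^sup>2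
                                  + (infnorm (Kh k))\<^sup>2 * (norm (column n (q k)))\<^sup>2)))"

definition D_a1_2 ::
  "('d option \<Rightarrow> real^'n::finite) \<Rightarrow> ('d option \<Rightarrow> real^'n^'m::finite) \<Rightarrow> 'd option \<Rightarrow> real^'n^'n" where
  "D_a1_2 Kh d1 k = diag_mat (\<lambda>n. infnorm (Kh k) * norm (column n (d1 k)))"

definition D_a2_2 ::
  "('d option \<Rightarrow> real^'n::finite) \<Rightarrow> ('d option \<Rightarrow> real^'n^'m::finite) \<Rightarrow> 'd option \<Rightarrow> real^'n^'n" where
  "D_a2_2 Kh d2 k = diag_mat (\<lambda>n. infnorm (Kh k) * norm (column n (d2 k)))"

definition D_a1_3 ::
  "('d option \<Rightarrow> real^'n::finite) \<Rightarrow> ('d option \<Rightarrow> real^'n^'m::finite) \<Rightarrow>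
   ('d option \<Rightarrow> real^'n^'m) \<Rightarrow> 'd option \<Rightarrow> real^'n^'n" where
  "D_a1_3 Kh d1 d2 k = diag_mat (\<lambda>n.
     sqrt ((D_a1_2 Kh d1 k $ n $ n)\<^sup>2 + (D_a2_2 Kh d2 k $ n $ n)\<^sup>2))"

definition D_a1_1 ::
  "real^'n::finite \<Rightarrow> ('d::finite option \<Rightarrow> real^'n) \<Rightarrow> ('d option \<Rightarrow> real^'n) \<Rightarrow>
   ('d option \<Rightarrow> real^'n^'m::finite) \<Rightarrow> ('d option \<Rightarrow> real^'n^'m) \<Rightarrow> ('d option \<Rightarrow> real^'n^'m) \<Rightarrow>
   real^'n^'n" where
  "D_a1_1 K Ki Kh d1 d2 q = diag_mat (\<lambda>n.
     sqrt ((D_a2_1 K Ki Kh d2 q $ n $ n)\<^sup>2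
        + (\<Sum>k\<in>UNIV. (infnorm (Ki k))\<^sup>2 * (norm (column n (d1 k)))\<^sup>2
                    + (D_a1_2 Kh d1 k $ n $ n)\<^sup>2 * (norm (column n (d2 k)))\<^sup>2)))"

definition D_d1_1 :: "real^'n^'n" where
  "D_d1_1 = mat 1"

definition D_d1_2 ::
  "('d option \<Rightarrow> real^'n::finite) \<Rightarrow> ('d option \<Rightarrow> real^'n) \<Rightarrow> ('d option \<Rightarrow> real^'n^'m::finite) \<Rightarrow>
   ('d option \<Rightarrow> real^'n^'m) \<Rightarrow> 'd option \<Rightarrow> real^'n^'n" where
  "D_d1_2 Ki Kh d1 d2 k = diag_mat (\<lambda>n.
     sqrt ((infnorm (Ki k))\<^sup>2 + (D_a1_3 Kh d1 d2 k $ n $ n)\<^sup>2))"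

definition D_d2_1 ::
  "('d option \<Rightarrow> real^'n::finite) \<Rightarrow> ('d option \<Rightarrow> real^'n) \<Rightarrow> ('d option \<Rightarrow> real^'n^'m::finite) \<Rightarrow>
   'd option \<Rightarrow> real^'n^'n" where
  "D_d2_1 Ki Kh d2 k = diag_mat (\<lambda>n.
     sqrt ((infnorm (Ki k))\<^sup>2 + (D_a2_2 Kh d2 k $ n $ n)\<^sup>2))"

definition D_d2_2 :: "real^'n^'n" where
  "D_d2_2 = mat 1"


section \<open>The layer separation loss\<close>

definition residual_row ::
  "real^'n::finite \<Rightarrow> ('d::finite option \<Rightarrow> real^'n) \<Rightarrow> ('d option \<Rightarrow> real^'n) \<Rightarrow> real^'n \<Rightarrow>
   (real \<Rightarrow> real) \<Rightarrow> real^'m::finite \<Rightarrow> real \<Rightarrow>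
   real^'n^'m \<Rightarrow> ('d option \<Rightarrow> real^'n^'m) \<Rightarrow> ('d option \<Rightarrow> real^'n^'m) \<Rightarrow> real^'n" where
  "residual_row K Ki Kh Y \<sigma> W3 b3 a2 d2 q =
    (let s0 = map_matrix \<sigma> a2; s1 = map_matrix (deriv \<sigma>) a2; s2 = map_matrix (deriv (deriv \<sigma>)) a2 in
       K * (W3 v* s0 + b3 *\<^sub>R 1)
     + Ki None * (W3 v* (s1 * d2 None))
     + Kh None * (W3 v* (s2 * d2 None * d2 None + s1 * q None))
     - (\<Sum>i\<in>UNIV. Ki (Some i) * (W3 v* (s1 * d2 (Some i))))
     - (\<Sum>i\<in>UNIV. Kh (Some i) * (W3 v* (s2 * d2 (Some i) * d2 (Some i) + s1 * q (Some i))))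
     - Y)"

definition layer_separation_loss ::
  "(real^'d::finite \<Rightarrow> real) \<Rightarrow> (real \<times> (real^'d) \<Rightarrow> real) \<Rightarrow> ('n::finite \<Rightarrow> real) \<Rightarrow> ('n \<Rightarrow> real^'d) \<Rightarrow>
   (real \<Rightarrow> real) \<Rightarrow> real^('d option)^'m::finite \<Rightarrow> real^'m^'m \<Rightarrow> real^'m \<Rightarrow>
   real^'m \<Rightarrow> real^'m \<Rightarrow> real \<Rightarrow>
   real^'n^'m \<Rightarrow> real^'n^'m \<Rightarrow>
   ('d option \<Rightarrow> real^'n^'m) \<Rightarrow> ('d option \<Rightarrow> real^'n^'m) \<Rightarrow> ('d option \<Rightarrow> real^'n^'m) \<Rightarrow> real" where
  "layer_separation_loss c Q t x \<sigma> W1 W2 W3 b1 b2 b3 a1 a2 d1 d2 q =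
    (let K = K_h c t x; Ki = Ki_h c t x; Kh = Ki_hat c t x;
         r1 = W1 ** XT_mat t x + times_ones b1 - a1;
         r2 = W2 ** map_matrix \<sigma> a1 + times_ones b2 - a2
     in 1 / real CARD('n) *
       ((norm (residual_row K Ki Kh (Y_row Q t x) \<sigma> W3 b3 a2 d2 q))\<^sup>2
        + omega_a1_1 W2 W3 * (diag_norm (D_a1_1 K Ki Kh d1 d2 q) r1)\<^sup>2
        + (\<Sum>k\<in>UNIV. omega_a1_2 W1 W2 W3 k * (diag_norm (D_a1_2 Kh d1 k) r1)\<^sup>2)
        + (\<Sum>k\<in>UNIV. omega_a1_3 W1 W2 W3 k * (diag_norm (D_a1_3 Kh d1 d2 k) r1)\<^sup>2)
        + omega_a2_1 W3 * (diag_norm (D_a2_1 K Ki Kh d2 q) r2)\<^sup>2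
        + (\<Sum>k\<in>UNIV. omega_a2_2 W1 W2 W3 k * (diag_norm (D_a2_2 Kh d2 k) r2)\<^sup>2)
        + (\<Sum>k\<in>UNIV.
              omega_d1_1 Kh W1 W2 W3 k * (diag_norm D_d1_1 (times_ones (column k W1) - d1 k))\<^sup>2
            + omega_d2_1 W3 * (diag_norm (D_d2_1 Ki Kh d2 k)
                (W2 ** (map_matrix (deriv \<sigma>) a1 * d1 k) - d2 k))\<^sup>2)
        + (\<Sum>k\<in>UNIV.
              omega_d1_2 W2 W3 * (diag_norm (D_d1_2 Ki Kh d1 d2 k) (times_ones (column k W1) - d1 k))\<^sup>2
            + omega_d2_2 Kh W1 W2 W3 k * (diag_norm D_d2_2
                (W2 ** (map_matrix (deriv \<sigma>) a1 * d1 k) - d2 k))\<^sup>2)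
        + (\<Sum>k\<in>UNIV. omega_q Kh W3 k *
              (norm (W2 ** (map_matrix (deriv (deriv \<sigma>)) a1 * d1 k * d1 k) - q k))\<^sup>2)))"

end

theory Submission
  imports Defs
begin

text \<open>
  Take the auxiliary variables to be the exact layer quantities of the network at the samples:
  the pre-activations \<open>a\<^sub>1\<close>, \<open>a\<^sub>2\<close>, their first derivatives \<open>d\<^bsub>1k\<^esub>\<close>, \<open>d\<^bsub>2k\<^esub>\<close> along the space-time
  direction \<open>k\<close>, and the part \<open>q\<^sub>k\<close> of the second derivative of \<open>a\<^sub>2\<close>; as \<open>a\<^sub>1\<close> is affine in the
  input, \<open>q\<^sub>k\<close> is the whole second derivative.  Every penalty then vanishes whatever its
  weight, and by the chain and product rules the residual row consists of the PDE residuals, so the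
  two losses even coincide.
\<close>

text \<open>Shifts in time and, by the next lemma, in space are steps along the axes
  \<open>None\<close> and \<open>Some i\<close> of the joint input space, so one derivative formula
  along \<open>axis k 1\<close> covers both.\<close>

lemma stack_add_time: "stack (s + h) y = stack s y + h *\<^sub>R axis None (1::real)"
  by (simp add: stack_def vec_eq_iff axis_def split: option.split)

lemma stack_add_space: "stack s (y + h *\<^sub>R axis i (1::real)) = stack s y + h *\<^sub>R axis (Some i) 1"
  by (simp add: stack_def vec_eq_iff axis_def split: option.split)

lemma has_derivative_twice_differentiable:
  assumes "twice_differentiable f"
  shows "(f has_real_derivative deriv f s) (at s)"
    and "(deriv f has_real_derivative deriv (deriv f) s) (at s)"
  using assms by (auto simp: twice_differentiable_def DERIV_deriv_iff_real_differentiable)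

lemma norm_square_line_has_derivative:
  "((\<lambda>h. (norm (y + h *\<^sub>R axis i 1))\<^sup>2) has_real_derivative 2 * (y + s *\<^sub>R axis i 1) $ i) (at s)"
  for y :: "real^'d::finite"
proof -
  have "(norm (y + h *\<^sub>R axis i 1))\<^sup>2 = (norm y)\<^sup>2 + 2 * h * y $ i + h\<^sup>2" for h
    unfolding power2_norm_eq_inner
    by (simp add: inner_add_left inner_add_right inner_axis inner_axis' power2_eq_square
        algebra_simps)
  then show ?thesis
    by (auto intro!: derivative_eq_intros)
qed

lemma partial_derivI:
  "((\<lambda>s. f (x + s *\<^sub>R axis i 1)) has_real_derivative D) (at 0) \<Longrightarrow> partial_deriv i f x = D"
  unfolding partial_deriv_def by (rule DERIV_imp_deriv)

text \<open>Chain rule along the affine line through \<open>x\<close>. It certifies that the value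
  chosen by \<open>deriv\<close> in \<open>partial_deriv\<close> is a true derivative; this is
  applied to \<open>c\<close>.\<close>

lemma has_partial_deriv:
  assumes "f differentiable (at x)"
  shows "((\<lambda>s. f (x + s *\<^sub>R axis i 1)) has_real_derivative partial_deriv i f x) (at 0)"
proof -
  have "(\<lambda>s. x + s *\<^sub>R axis i 1) differentiable (at (0::real))"
    by (intro derivative_intros)
  moreover from assms have "f differentiable (at (x + 0 *\<^sub>R axis i 1))"
    by simp
  ultimately have "(f \<circ> (\<lambda>s. x + s *\<^sub>R axis i 1)) differentiable (at (0::real))"
    by (intro differentiable_chain_at)
  then show ?thesis
    by (simp add: o_def partial_deriv_def DERIV_deriv_iff_real_differentiable)
qed

lemma diag_norm_zero [simp]: "diag_norm D 0 = 0"
  by (simp add: diag_norm_def column_def zero_vec_def[symmetric])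

section \<open>The network as a function of one space-time input, and its derivatives along an
  axis\<close>

locale two_layer_network =
  fixes \<sigma> :: "real \<Rightarrow> real"
    and W1 :: "real^('d::finite option)^'m::finite"
    and W2 :: "real^'m^'m"
    and W3 b1 b2 :: "real^'m"
    and b3 :: real
  assumes twice_diff: "twice_differentiable \<sigma>"
begin

definition pre1 :: "real^('d option) \<Rightarrow> 'm \<Rightarrow> real" where
  "pre1 \<xi> j = (W1 *v \<xi> + b1) $ j"

definition pre2 :: "real^('d option) \<Rightarrow> 'm \<Rightarrow> real" where
  "pre2 \<xi> j = (\<Sum>l\<in>UNIV. W2 $ j $ l * \<sigma> (pre1 \<xi> l)) + b2 $ j"

definition pre2' :: "'d option \<Rightarrow> real^('d option) \<Rightarrow> 'm \<Rightarrow> real" where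
  "pre2' k \<xi> j = (\<Sum>l\<in>UNIV. W2 $ j $ l * (deriv \<sigma> (pre1 \<xi> l) * W1 $ l $ k))"

text \<open>Second derivative of \<open>pre2\<close> along \<open>axis k 1\<close>. As
  \<open>pre1\<close> is affine, only the derivative of the factor \<open>deriv \<sigma>\<close> in
  \<open>pre2'\<close> contributes.\<close>

definition pre2'' :: "'d option \<Rightarrow> real^('d option) \<Rightarrow> 'm \<Rightarrow> real" where
  "pre2'' k \<xi> j =
     (\<Sum>l\<in>UNIV. W2 $ j $ l * (deriv (deriv \<sigma>) (pre1 \<xi> l) * W1 $ l $ k * W1 $ l $ k))"

definition out :: "real^('d option) \<Rightarrow> real" where
  "out \<xi> = (\<Sum>j\<in>UNIV. W3 $ j * \<sigma> (pre2 \<xi> j)) + b3"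

definition out' :: "'d option \<Rightarrow> real^('d option) \<Rightarrow> real" where
  "out' k \<xi> = (\<Sum>j\<in>UNIV. W3 $ j * (deriv \<sigma> (pre2 \<xi> j) * pre2' k \<xi> j))"

definition out'' :: "'d option \<Rightarrow> real^('d option) \<Rightarrow> real" where
  "out'' k \<xi> = (\<Sum>j\<in>UNIV. W3 $ j *
     (deriv (deriv \<sigma>) (pre2 \<xi> j) * pre2' k \<xi> j * pre2' k \<xi> j + deriv \<sigma> (pre2 \<xi> j) * pre2'' k \<xi> j))"

lemma network_eq_out: "network \<sigma> W1 W2 W3 b1 b2 b3 s y = out (stack s y)"
  by (simp add: network_def out_def pre2_def pre1_def inner_vec_def map_vec_def
      matrix_vector_mult_def)

lemmas DERIV_act = DERIV_chain2[OF has_derivative_twice_differentiable(1)[OF twice_diff]]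
lemmas DERIV_act' = DERIV_chain2[OF has_derivative_twice_differentiable(2)[OF twice_diff]]

lemma DERIV_pre1:
  "((\<lambda>h. pre1 (\<xi> + h *\<^sub>R axis k 1) j) has_real_derivative W1 $ j $ k) (at s)"
proof -
  have "pre1 (\<xi> + h *\<^sub>R axis k 1) j = pre1 \<xi> j + h * W1 $ j $ k" for h
    by (simp add: pre1_def matrix_vector_right_distrib matrix_vector_mult_scaleR
        matrix_vector_mult_basis column_def)
  then show ?thesis
    by (auto intro!: derivative_eq_intros)
qed

text \<open>Stated at every point \<open>s\<close> of the line, not just at its base point, so that
  the derivative is known as a function and can be differentiated again in time.\<close>

lemma DERIV_pre2:
  "((\<lambda>h. pre2 (\<xi> + h *\<^sub>R axis k 1) j) has_real_derivative pre2' k (\<xi> + s *\<^sub>R axis k 1) j) (at s)"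
  unfolding pre2_def pre2'_def
  by (rule derivative_eq_intros DERIV_sum DERIV_act DERIV_pre1 refl | simp add: mult_ac)+

lemma DERIV_pre2':
  "((\<lambda>h. pre2' k (\<xi> + h *\<^sub>R axis k 1) j) has_real_derivative pre2'' k (\<xi> + s *\<^sub>R axis k 1) j) (at s)"
  unfolding pre2'_def pre2''_def
  by (rule derivative_eq_intros DERIV_sum DERIV_act' DERIV_pre1 refl | simp add: mult_ac)+

lemma DERIV_out:
  "((\<lambda>h. out (\<xi> + h *\<^sub>R axis k 1)) has_real_derivative out' k (\<xi> + s *\<^sub>R axis k 1)) (at s)"
  unfolding out_def out'_def
  by (rule derivative_eq_intros DERIV_sum DERIV_act DERIV_pre2 refl | simp add: mult_ac)+

lemma DERIV_out':
  "((\<lambda>h. out' k (\<xi> + h *\<^sub>R axis k 1)) has_real_derivative out'' k (\<xi> + s *\<^sub>R axis k 1)) (at s)"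
  unfolding out'_def out''_def
  by (rule derivative_eq_intros DERIV_sum DERIV_act' DERIV_pre2 DERIV_pre2' refl
      | simp add: algebra_simps)+

lemma DERIV_out_time:
  "((\<lambda>s. out (stack s y)) has_real_derivative out' None (stack s y)) (at s)"
  "((\<lambda>s. out' None (stack s y)) has_real_derivative out'' None (stack s y)) (at s)"
  \<comment> \<open>On the line based at time 0 the parameter is the time itself.\<close>
  using DERIV_out[of "stack 0 y" None s] DERIV_out'[of None "stack 0 y" s]
  by (simp_all flip: stack_add_time)

lemma DERIV_out_space:
  "((\<lambda>h. out (stack s (y + h *\<^sub>R axis i 1))) has_real_derivative out' (Some i) (stack s y)) (at 0)"
  "((\<lambda>h. out' (Some i) (stack s (y + h *\<^sub>R axis i 1))) has_real_derivative
      out'' (Some i) (stack s y)) (at 0)"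
  using DERIV_out[of "stack s y" "Some i" 0] DERIV_out'[of "Some i" "stack s y" 0]
  by (simp_all add: stack_add_space)

section \<open>The hyperbolic operator applied to \<open>psi_h\<close>\<close>

lemma psi_h_eq: "psi_h \<sigma> W1 W2 W3 b1 b2 b3 s y = s\<^sup>2 * ((norm y)\<^sup>2 - 1) * out (stack s y)"
  by (simp add: psi_h_def network_eq_out)

lemma deriv2_psi_h:
  "deriv (deriv (\<lambda>s. psi_h \<sigma> W1 W2 W3 b1 b2 b3 s y)) s =
     ((norm y)\<^sup>2 - 1) *
       (2 * out (stack s y) + 4 * s * out' None (stack s y) + s\<^sup>2 * out'' None (stack s y))"
proof -
  \<comment> \<open>The first time derivative is needed as an equation of functions, since the outer
    \<open>deriv\<close> acts on the whole function.\<close>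
  have "deriv (\<lambda>s. psi_h \<sigma> W1 W2 W3 b1 b2 b3 s y) =
      (\<lambda>s. ((norm y)\<^sup>2 - 1) * (2 * s * out (stack s y) + s\<^sup>2 * out' None (stack s y)))"
    unfolding psi_h_eq
    by (rule ext, rule DERIV_imp_deriv)
       (rule derivative_eq_intros DERIV_out_time refl | simp add: algebra_simps)+
  moreover have "deriv
      (\<lambda>s. ((norm y)\<^sup>2 - 1) * (2 * s * out (stack s y) + s\<^sup>2 * out' None (stack s y))) s =
      ((norm y)\<^sup>2 - 1) *
       (2 * out (stack s y) + 4 * s * out' None (stack s y) + s\<^sup>2 * out'' None (stack s y))"
    by (rule DERIV_imp_deriv)
       (rule derivative_eq_intros DERIV_out_time refl | simp add: algebra_simps)+
  ultimately show ?thesis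
    by simp
qed

lemma partial_deriv_psi_h:
  "partial_deriv i (psi_h \<sigma> W1 W2 W3 b1 b2 b3 s) y =
     s\<^sup>2 * (2 * y $ i * out (stack s y) + ((norm y)\<^sup>2 - 1) * out' (Some i) (stack s y))"
proof (rule partial_derivI)
  show "((\<lambda>h. psi_h \<sigma> W1 W2 W3 b1 b2 b3 s (y + h *\<^sub>R axis i 1)) has_real_derivative
      s\<^sup>2 * (2 * y $ i * out (stack s y) + ((norm y)\<^sup>2 - 1) * out' (Some i) (stack s y))) (at 0)"
    unfolding psi_h_eq
    by (rule derivative_eq_intros norm_square_line_has_derivative DERIV_out_space refl
        | simp add: algebra_simps)+
qed

text \<open>Product rule for \<open>c\<close> times the closed form of the partial derivative of
  \<open>psi_h\<close>. The factor 4 collects two equal terms \<open>2 * y $ i * out'\<close>: one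
  from differentiating \<open>out\<close>, one from differentiating the squared norm.\<close>

lemma partial_deriv_flux:
  assumes "c differentiable (at y)"
  shows "partial_deriv i (\<lambda>y. (c y *\<^sub>R grad (psi_h \<sigma> W1 W2 W3 b1 b2 b3 s) y) $ i) y =
     partial_deriv i c y *
       (s\<^sup>2 * (2 * y $ i * out (stack s y) + ((norm y)\<^sup>2 - 1) * out' (Some i) (stack s y))) +
     c y * (s\<^sup>2 * (2 * out (stack s y) + 4 * y $ i * out' (Some i) (stack s y)
       + ((norm y)\<^sup>2 - 1) * out'' (Some i) (stack s y)))" (is "_ = ?D")
proof (rule partial_derivI)
  have comp: "((\<lambda>h. (y + h *\<^sub>R axis i 1) $ i) has_real_derivative 1) (at 0)"
    by (auto intro!: derivative_eq_intros)
  show "((\<lambda>h. (c (y + h *\<^sub>R axis i 1) *\<^sub>R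
      grad (psi_h \<sigma> W1 W2 W3 b1 b2 b3 s) (y + h *\<^sub>R axis i 1)) $ i) has_real_derivative ?D) (at 0)"
    \<comment> \<open>The closed form holds at every point, so it may replace the inner partial
      derivative along the whole line.\<close>
    unfolding grad_def vector_scaleR_component vec_lambda_beta partial_deriv_psi_h real_scaleR_def
    by (rule derivative_eq_intros norm_square_line_has_derivative DERIV_out_space comp
        has_partial_deriv[OF assms] refl
        | simp add: algebra_simps)+
qed

section \<open>The exact layer quantities at the samples\<close>

definition a1_exact :: "('n::finite \<Rightarrow> real) \<Rightarrow> ('n \<Rightarrow> real^'d) \<Rightarrow> real^'n^'m" where
  "a1_exact t x = W1 ** XT_mat t x + times_ones b1"

definition a2_exact :: "('n::finite \<Rightarrow> real) \<Rightarrow> ('n \<Rightarrow> real^'d) \<Rightarrow> real^'n^'m" where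
  "a2_exact t x = W2 ** map_matrix \<sigma> (a1_exact t x) + times_ones b2"

definition d1_exact :: "'d option \<Rightarrow> real^'n::finite^'m" where
  "d1_exact k = times_ones (column k W1)"

definition d2_exact :: "('n::finite \<Rightarrow> real) \<Rightarrow> ('n \<Rightarrow> real^'d) \<Rightarrow> 'd option \<Rightarrow> real^'n^'m" where
  "d2_exact t x k = W2 ** (map_matrix (deriv \<sigma>) (a1_exact t x) * d1_exact k)"

definition q_exact :: "('n::finite \<Rightarrow> real) \<Rightarrow> ('n \<Rightarrow> real^'d) \<Rightarrow> 'd option \<Rightarrow> real^'n^'m" where
  "q_exact t x k = W2 ** (map_matrix (deriv (deriv \<sigma>)) (a1_exact t x) * d1_exact k * d1_exact k)"

text \<open>Links the matrix and pointwise views: column \<open>n\<close> of each matrix holds the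
  layer quantity at the \<open>n\<close>-th sample.\<close>

lemma exact_component:
  "a1_exact t x $ j $ n = pre1 (stack (t n) (x n)) j"
  "a2_exact t x $ j $ n = pre2 (stack (t n) (x n)) j"
  "d2_exact t x k $ j $ n = pre2' k (stack (t n) (x n)) j"
  "q_exact t x k $ j $ n = pre2'' k (stack (t n) (x n)) j"
proof -
  have XT: "XT_mat t x $ l $ n = stack (t n) (x n) $ l" for l
    by (simp add: XT_mat_def stack_def T_row_def X_mat_def split: option.split)
  \<comment> \<open>Proved for all \<open>j\<close>, because the second layer sums over every entry
    of a column.\<close>
  show a1: "a1_exact t x $ j $ n = pre1 (stack (t n) (x n)) j" for j
    by (simp add: a1_exact_def pre1_def times_ones_def matrix_matrix_mult_def
        matrix_vector_mult_def XT)
  show "a2_exact t x $ j $ n = pre2 (stack (t n) (x n)) j"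
    "d2_exact t x k $ j $ n = pre2' k (stack (t n) (x n)) j"
    "q_exact t x k $ j $ n = pre2'' k (stack (t n) (x n)) j"
    by (simp_all add: a2_exact_def pre2_def d2_exact_def pre2'_def q_exact_def pre2''_def
        d1_exact_def times_ones_def matrix_matrix_mult_def map_matrix_def a1 column_def)
qed

lemma residual_row_exact:
  assumes "c differentiable (at (x n))"
  shows "residual_row (K_h c t x) (Ki_h c t x) (Ki_hat c t x) (Y_row Q t x) \<sigma> W3 b3
      (a2_exact t x) (d2_exact t x) (q_exact t x) $ n =
    hyperbolic_op c (psi_h \<sigma> W1 W2 W3 b1 b2 b3) (t n) (x n) - Q (t n, x n)"
proof -
  define \<xi> where "\<xi> = stack (t n) (x n)"
  have rows:
    \<comment> \<open>\<open>out\<close> contains the bias, which the residual row adds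
      separately.\<close>
    "(W3 v* map_matrix \<sigma> (a2_exact t x)) $ n = out \<xi> - b3"
    "(W3 v* (map_matrix (deriv \<sigma>) (a2_exact t x) * d2_exact t x k)) $ n = out' k \<xi>"
    "(W3 v* (map_matrix (deriv (deriv \<sigma>)) (a2_exact t x) * d2_exact t x k * d2_exact t x k
        + map_matrix (deriv \<sigma>) (a2_exact t x) * q_exact t x k)) $ n = out'' k \<xi>" for k
    by (simp_all add: vector_matrix_mult_def map_matrix_def exact_component out_def out'_def
        out''_def \<xi>_def mult.commute)
  show ?thesis
    unfolding residual_row_def Let_def vector_minus_component vector_add_component
      vector_mult_component sum_component rows hyperbolic_op_def divergence_def deriv2_psi_h
      partial_deriv_flux[OF assms] \<xi>_def[symmetric]
    \<comment> \<open>Compare coefficients of \<open>out\<close>, \<open>out'\<close> and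
      \<open>out''\<close>. In the divergence the term \<open>2 * out\<close> does not depend on
      \<open>i\<close>, so summing it yields the factor \<open>real CARD('d)\<close> in
      \<open>K_h\<close>.\<close>
    by (simp add: K_h_def K0_hat_def X_hat_def T_hat_def T_row_def at_samples_def X_mat_def row_def
        Y_row_def sum.distrib sum_distrib_left sum_distrib_right algebra_simps sum_subtractf)
qed

lemma layer_separation_loss_exact:
  fixes t :: "'n::finite \<Rightarrow> real"
  assumes "\<And>n. c differentiable (at (x n))"
  shows "layer_separation_loss c Q t x \<sigma> W1 W2 W3 b1 b2 b3
      (a1_exact t x) (a2_exact t x) d1_exact (d2_exact t x) (q_exact t x) =
    pinn_loss c Q t x \<sigma> W1 W2 W3 b1 b2 b3"
proof -
  have penalties:
    "W1 ** XT_mat t x + times_ones b1 - a1_exact t x = 0"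
    "W2 ** map_matrix \<sigma> (a1_exact t x) + times_ones b2 - a2_exact t x = 0"
    \<comment> \<open>The annotation fixes the number of columns, which \<open>k\<close> and
      \<open>W1\<close> leave open.\<close>
    "times_ones (column k W1) - (d1_exact k :: real^'n^'m) = 0"
    "W2 ** (map_matrix (deriv \<sigma>) (a1_exact t x) * d1_exact k) - d2_exact t x k = 0"
    "W2 ** (map_matrix (deriv (deriv \<sigma>)) (a1_exact t x) * d1_exact k * d1_exact k)
       - q_exact t x k = 0" for k
    by (simp_all add: a1_exact_def a2_exact_def d1_exact_def d2_exact_def q_exact_def)
  have norm_sq: "(norm v)\<^sup>2 = (\<Sum>n\<in>UNIV. \<bar>v $ n\<bar>\<^sup>2)" for v :: "real^'n"
    unfolding power2_norm_eq_inner by (simp add: inner_vec_def power2_eq_square)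
  show ?thesis
    unfolding layer_separation_loss_def pinn_loss_def Let_def penalties norm_sq
      residual_row_exact[OF assms]
    by simp
qed

end

theorem theorem3p4:
  fixes \<sigma> :: "real \<Rightarrow> real"
    and T \<delta> :: real
    and c :: "real^'d::finite \<Rightarrow> real"
    and U :: "(real^'d) set"
    and Q :: "real \<times> (real^'d) \<Rightarrow> real"
    and t :: "'n::finite \<Rightarrow> real"
    and x :: "'n \<Rightarrow> real^'d"
    and W1 :: "real^('d option)^'m::finite"
    and W2 :: "real^'m^'m"
    and W3 b1 b2 :: "real^'m"
    and b3 :: real
  assumes "T > 0"
    and "open U" and "cball 0 1 \<subseteq> U" and "continuously_differentiable_on c U"
    and "\<delta> > 0" and "\<And>y. y \<in> cball 0 1 \<Longrightarrow> c y > \<delta>"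
    and "\<And>n. t n \<in> {0..T}" and "\<And>n. x n \<in> cball 0 1"
    and "twice_differentiable \<sigma>"
  shows "\<exists>(a1 :: real^'n^'m) (a2 :: real^'n^'m)
            (d1 :: 'd option \<Rightarrow> real^'n^'m) (d2 :: 'd option \<Rightarrow> real^'n^'m) (q :: 'd option \<Rightarrow> real^'n^'m).
           layer_separation_loss c Q t x \<sigma> W1 W2 W3 b1 b2 b3 a1 a2 d1 d2 q
             \<le> pinn_loss c Q t x \<sigma> W1 W2 W3 b1 b2 b3"
proof -
  interpret two_layer_network \<sigma> W1 W2 W3 b1 b2 b3
    using assms(9) by unfold_locales
  \<comment> \<open>Samples on the unit sphere are covered too: the open set \<open>U\<close>
    contains the closed ball, so differentiability on \<open>U\<close> is differentiability at each
    sample.\<close>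
  have "c differentiable (at (x n))" for n
    using assms(2,3,4,8) unfolding continuously_differentiable_on_def
    by (meson differentiable_on_eq_differentiable_at subsetD)
  note layer_separation_loss_exact[where c = c and x = x and t = t and Q = Q, OF this]
  from eq_refl[OF this] show ?thesis
    by (intro exI)
qed

end
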